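(* Let $X$ be a metric space. Then $\sqrt{a(X)}\le opa(X)$, where $a(X)$ is the sparsification number of $X$ and $opa(X)$ is the operator norm localization number of $X$.
   Context: Metric Sparsification Property: a metric space $X$ has MS($c$), $0<c\le 1$, if there is a non-decreasing function $f:\mathbf{N}\to\mathbf{N}$ such that for all $m\in\mathbf{N}$ and every finite positive Borel measure $\mu$ on $X$ there is a Borel subset $\Omega=\bigsqcup_{i\in I}\Omega_i$ of $X$ with (i) $d(\Omega_i,\Omega_j)\ge m$ for all $i\ne j$; (ii) $\mathrm{Diam}(\Omega_i)\le f(m)$ for all $i$; (iii) $\mu(\Omega)\ge c\,\mu(X)$. The sparsification number $a(X)$ is the supremum of all $c$ such that $X$ has MS($c$) (and $0$ if there is none). Here $d(A,B)=\inf\{d(a,b):a\in A,b\in B\}$. Operator norm localization: let $H$ be a separable infinite-dimensional Hilbert space. A Borel measure on a metric space is locally finite if bounded Borel sets have finite measure; the positive measures $\nu$ below are understood to be nonzero. For a positive locally finite Borel measure $\nu$ on $X$, a bounded operator $T$ on $L^2(X,\nu)\otimes H$ has propagation at most $r$ if $\langle T\varphi,\psi\rangle=0$ whenever $d(\mathrm{Supp}(\varphi),\mathrm{Supp}(\psi))>r$; $\mathcal{A}_r(X,\nu)$ is the set of such operators. $X$ has the operator norm localization property with constant $c$ ($0<c\le1$) if there is a non-decreasing $f:\mathbf{N}\to\mathbf{N}$ such that for every positive locally finite Borel measure $\nu$ on $X$, every $k\in\mathbf{N}$ and every $T\in\mathcal{A}_k(X,\nu)$ there is a nonzero $\varphi\in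 L^2(X,\nu)\otimes H$ with $\mathrm{Diam}(\mathrm{Supp}(\varphi))\le f(k)$ and $\|T\varphi\|\ge c\|T\|\|\varphi\|$. The operator norm localization number $opa(X)$ is the supremum of all such constants $c$ (and $0$ if there is none). *)

theory Defs
  imports "HOL-Analysis.Analysis"
begin

text \<open>
  Distances between sets and diameters take values in \<^typ>\<open>ennreal\<close>: the distance to the
  empty set is infinite (the infimum of the empty set), the diameter of the empty set is \<open>0\<close>,
  and an unbounded set has infinite diameter. The library's \<^const>\<open>setdist\<close> and
  \<^const>\<open>diameter\<close> return default values in the degenerate cases.
\<close>

definition set_edist :: "'a::metric_space set \<Rightarrow> 'a set \<Rightarrow> ennreal" where
  "set_edist A B = (INF a\<in>A. INF b\<in>B. ennreal (dist a b))"

definition ediam :: "'a::metric_space set \<Rightarrow> ennreal" where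
  "ediam A = (SUP a\<in>A. SUP b\<in>A. ennreal (dist a b))"


section \<open>Metric sparsification\<close>

text \<open>
  The decomposition of \<open>\<Omega>\<close> is the set \<open>P\<close> of its pieces. Disjointness has to be
  required separately because of the case \<open>m = 0\<close>.
\<close>

definition metric_sparsification :: "'a::metric_space itself \<Rightarrow> real \<Rightarrow> bool" where
  "metric_sparsification X c \<longleftrightarrow>
     0 < c \<and> c \<le> 1 \<and>
     (\<exists>f :: nat \<Rightarrow> nat. mono f \<and>
       (\<forall>m. \<forall>\<mu> :: 'a measure. finite_measure \<mu> \<and> sets \<mu> = sets borel \<longrightarrow>
         (\<exists>\<Omega> P. \<Omega> \<in> sets borel \<and> \<Omega> = \<Union>P \<and> disjoint P \<and>
            (\<forall>A\<in>P. \<forall>B\<in>P. A \<noteq> B \<longrightarrow> set_edist A B \<ge> of_nat m) \<and>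
            (\<forall>A\<in>P. ediam A \<le> of_nat (f m)) \<and>
            measure \<mu> \<Omega> \<ge> c * measure \<mu> UNIV)))"

definition sparsification_number :: "'a::metric_space itself \<Rightarrow> real" where
  "sparsification_number X =
     (if \<exists>c. metric_sparsification X c then Sup {c. metric_sparsification X c} else 0)"


section \<open>Complex Hilbert spaces\<close>

text \<open>
  The inner product is linear in the first and conjugate-linear in the second argument.
  A complex Hilbert space is a type in both this class and \<^class>\<open>complete_space\<close>; it is
  separable iff it is in \<^class>\<open>second_countable_topology\<close>.
\<close>

class complex_inner = real_normed_vector +
  fixes scaleC :: "complex \<Rightarrow> 'a \<Rightarrow> 'a"
    and cinner :: "'a \<Rightarrow> 'a \<Rightarrow> complex"
  assumes scaleC_add_right: "scaleC a (x + y) = scaleC a x + scaleC a y"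
    and scaleC_add_left: "scaleC (a + b) x = scaleC a x + scaleC b x"
    and scaleC_scaleC: "scaleC a (scaleC b x) = scaleC (a * b) x"
    and scaleC_one: "scaleC 1 x = x"
    and scaleR_scaleC: "scaleR r x = scaleC (complex_of_real r) x"
    and cinner_commute: "cinner x y = cnj (cinner y x)"
    and cinner_add_left: "cinner (x + y) z = cinner x z + cinner y z"
    and cinner_scaleC_left: "cinner (scaleC a x) y = a * cinner x y"
    and cinner_self: "cinner x x = complex_of_real ((norm x)\<^sup>2)"

interpretation complex_inner: vector_space "scaleC :: complex \<Rightarrow> 'a \<Rightarrow> 'a::complex_inner"
  by unfold_locales (simp_all add: scaleC_add_right scaleC_add_left scaleC_scaleC scaleC_one)

instantiation complex :: complex_inner
begin

definition "scaleC_complex = (\<lambda>(a::complex) (x::complex). a * x)"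
definition "cinner_complex = (\<lambda>(x::complex) (y::complex). x * cnj y)"

instance
  by standard
    (simp_all add: scaleC_complex_def cinner_complex_def algebra_simps scaleR_conv_of_real
      complex_mult_cnj cmod_power2 flip: complex_norm_square)

end

definition infinite_dimensional :: "'h::complex_inner itself \<Rightarrow> bool" where
  "infinite_dimensional H \<longleftrightarrow>
     \<not> (\<exists>B :: 'h set. finite B \<and> module.span scaleC B = UNIV)"


section \<open>The space \<open>L\<^sup>2(X,\<nu>) \<otimes> H\<close>\<close>

text \<open>
  As usual, \<open>L\<^sup>2(X,\<nu>) \<otimes> H\<close> is identified with the space \<open>L\<^sup>2(X,\<nu>;H)\<close> of square-integrable
  \<open>H\<close>-valued functions (\<open>H\<close> is separable, so Borel measurability is strong measurability).
  Its elements are given by representatives, equality being equality almost everywhere.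
\<close>

definition L2 :: "'a measure \<Rightarrow> ('a \<Rightarrow> 'h::complex_inner) set" where
  "L2 \<nu> = {\<phi>. \<phi> \<in> borel_measurable \<nu> \<and> integrable \<nu> (\<lambda>x. (norm (\<phi> x))\<^sup>2)}"

definition norm_L2 :: "'a measure \<Rightarrow> ('a \<Rightarrow> 'h::complex_inner) \<Rightarrow> real" where
  "norm_L2 \<nu> \<phi> = sqrt (\<integral>x. (norm (\<phi> x))\<^sup>2 \<partial>\<nu>)"

definition cinner_L2 :: "'a measure \<Rightarrow> ('a \<Rightarrow> 'h::complex_inner) \<Rightarrow> ('a \<Rightarrow> 'h) \<Rightarrow> complex" where
  "cinner_L2 \<nu> \<phi> \<psi> = (\<integral>x. cinner (\<phi> x) (\<psi> x) \<partial>\<nu>)"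

text \<open>
  The support of a class of functions: the complement of the union of all open sets on which
  it vanishes almost everywhere.
\<close>

definition Supp :: "'a::topological_space measure \<Rightarrow> ('a \<Rightarrow> 'h::complex_inner) \<Rightarrow> 'a set" where
  "Supp \<nu> \<phi> = - \<Union>{U. open U \<and> (AE x in \<nu>. x \<in> U \<longrightarrow> \<phi> x = 0)}"

definition bounded_operator_L2 ::
    "'a measure \<Rightarrow> (('a \<Rightarrow> 'h::complex_inner) \<Rightarrow> ('a \<Rightarrow> 'h)) \<Rightarrow> bool" where
  "bounded_operator_L2 \<nu> T \<longleftrightarrow>
     (\<forall>\<phi>\<in>L2 \<nu>. T \<phi> \<in> L2 \<nu>) \<and>
     (\<forall>\<phi>\<in>L2 \<nu>. \<forall>\<psi>\<in>L2 \<nu>. (AE x in \<nu>. \<phi> x = \<psi> x) \<longrightarrow> (AE x in \<nu>. T \<phi> x = T \<psi> x)) \<and>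
     (\<forall>\<phi>\<in>L2 \<nu>. \<forall>\<psi>\<in>L2 \<nu>. AE x in \<nu>. T (\<lambda>y. \<phi> y + \<psi> y) x = T \<phi> x + T \<psi> x) \<and>
     (\<forall>a. \<forall>\<phi>\<in>L2 \<nu>. AE x in \<nu>. T (\<lambda>y. scaleC a (\<phi> y)) x = scaleC a (T \<phi> x)) \<and>
     (\<exists>K. \<forall>\<phi>\<in>L2 \<nu>. norm_L2 \<nu> (T \<phi>) \<le> K * norm_L2 \<nu> \<phi>)"

definition opnorm_L2 ::
    "'a measure \<Rightarrow> (('a \<Rightarrow> 'h::complex_inner) \<Rightarrow> ('a \<Rightarrow> 'h)) \<Rightarrow> real" where
  "opnorm_L2 \<nu> T = Sup {norm_L2 \<nu> (T \<phi>) |\<phi>. \<phi> \<in> L2 \<nu> \<and> norm_L2 \<nu> \<phi> \<le> 1}"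


section \<open>Operator norm localization\<close>

definition locally_finite_borel_measure :: "'a::metric_space measure \<Rightarrow> bool" where
  "locally_finite_borel_measure \<nu> \<longleftrightarrow>
     sets \<nu> = sets borel \<and> (\<forall>B\<in>sets borel. bounded B \<longrightarrow> emeasure \<nu> B < \<infinity>)"

text \<open>The operators of propagation at most \<open>r\<close>, written \<open>\<A>\<^sub>r(X,\<nu>)\<close>.\<close>

definition propagation_ops ::
    "real \<Rightarrow> 'a::metric_space measure \<Rightarrow> (('a \<Rightarrow> 'h::complex_inner) \<Rightarrow> ('a \<Rightarrow> 'h)) set" where
  "propagation_ops r \<nu> = {T. bounded_operator_L2 \<nu> T \<and>
     (\<forall>\<phi>\<in>L2 \<nu>. \<forall>\<psi>\<in>L2 \<nu>. set_edist (Supp \<nu> \<phi>) (Supp \<nu> \<psi>) > ennreal r \<longrightarrow>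
        cinner_L2 \<nu> (T \<phi>) \<psi> = 0)}"

definition operator_norm_localization ::
    "'a::metric_space itself \<Rightarrow> 'h::complex_inner itself \<Rightarrow> real \<Rightarrow> bool" where
  "operator_norm_localization X H c \<longleftrightarrow>
     0 < c \<and> c \<le> 1 \<and>
     (\<exists>f :: nat \<Rightarrow> nat. mono f \<and>
       (\<forall>\<nu> :: 'a measure. locally_finite_borel_measure \<nu> \<and> emeasure \<nu> UNIV \<noteq> 0 \<longrightarrow>
         (\<forall>k. \<forall>T \<in> propagation_ops (real k) \<nu>.
           \<exists>\<phi> :: 'a \<Rightarrow> 'h. \<phi> \<in> L2 \<nu> \<and> \<not> (AE x in \<nu>. \<phi> x = 0) \<and>
             ediam (Supp \<nu> \<phi>) \<le> of_nat (f k) \<and>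
             norm_L2 \<nu> (T \<phi>) \<ge> c * opnorm_L2 \<nu> T * norm_L2 \<nu> \<phi>)))"

definition opa :: "'a::metric_space itself \<Rightarrow> 'h::complex_inner itself \<Rightarrow> real" where
  "opa X H =
     (if \<exists>c. operator_norm_localization X H c
      then Sup {c. operator_norm_localization X H c} else 0)"

end

theory Submission
  imports Defs
begin

text \<open>
  Let \<open>T\<close> have propagation \<open>k\<close> and norm \<open>L\<close>, let \<open>\<xi>\<close> almost attain the norm, and sparsify the measure
  \<open>|\<xi>|\<^sup>2\<nu>\<close> at scale \<open>2k + 3\<close>. Since \<open>\<xi>\<close> is almost a maximal eigenvector of \<open>T\<^sup>*T\<close>, its restriction
  \<open>\<eta> = 1\<^sub>\<Omega>\<xi>\<close> satisfies \<open>\<langle>T\<eta>, T\<xi>\<rangle> \<approx> L\<^sup>2\<parallel>\<eta>\<parallel>\<^sup>2\<close>, hence \<open>\<parallel>T\<eta>\<parallel> \<ge> (sqrt c - \<epsilon>) L \<parallel>\<eta>\<parallel>\<close>. The images under \<open>T\<close> of the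
  pieces of \<open>\<eta>\<close> have disjoint supports, so the same inequality holds for one of the pieces, and the
  pieces have uniformly bounded diameter.
\<close>

section \<open>Polarization and Cauchy-Schwarz for real quadratic forms\<close>

text \<open>Polarization: the cross term is expressed by squared norms alone. The identity can then
  be integrated over \<open>\<nu>\<close> knowing only that squared norms are integrable, without
  touching the inner product of two functions.\<close>

lemma norm_scaleR_add_sq:
  fixes x y :: "'h::complex_inner"
  shows "(norm (u *\<^sub>R x + v *\<^sub>R y))\<^sup>2 =
    u\<^sup>2 * (norm x)\<^sup>2 + v\<^sup>2 * (norm y)\<^sup>2 + u * v * ((norm (x + y))\<^sup>2 - (norm x)\<^sup>2 - (norm y)\<^sup>2)"
proof -
  have add_sq: "(norm (a + b))\<^sup>2 = (norm a)\<^sup>2 + (norm b)\<^sup>2 + 2 * Re (cinner a b)" for a b :: 'h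
  proof -
    have right: "cinner z (a + b) = cinner z a + cinner z b" for z
      by (metis cinner_add_left cinner_commute complex_cnj_add)
    have "complex_of_real ((norm (a + b))\<^sup>2) =
        cinner a a + cinner b b + (cinner a b + cinner b a)"
      by (simp add: cinner_self[symmetric] cinner_add_left right del: of_real_power)
    also have "cinner a b + cinner b a = complex_of_real (2 * Re (cinner a b))"
      by (subst (2) cinner_commute) (simp add: complex_add_cnj)
    finally have "complex_of_real ((norm (a + b))\<^sup>2) =
        complex_of_real ((norm a)\<^sup>2 + (norm b)\<^sup>2 + 2 * Re (cinner a b))"
      by (simp add: cinner_self)
    then show ?thesis
      by (simp only: of_real_eq_iff)
  qed
  have left: "cinner (r *\<^sub>R a) b = of_real r * cinner a b" for r and a b :: 'h
    by (simp add: scaleR_scaleC cinner_scaleC_left)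
  have right: "cinner a (r *\<^sub>R b) = of_real r * cinner a b" for r and a b :: 'h
    by (subst cinner_commute, subst left) (simp add: cinner_commute[of a b])
  show ?thesis
    by (simp add: add_sq left right power_mult_distrib)
qed

text \<open>The determinant of a positive semidefinite form is nonnegative. Stated for bare real
  coefficients, it serves both the form of \<open>T\<close> and the defect form
  \<open>L^2<x,y> - <Tx,Ty>\<close>.\<close>

lemma quadratic_form_Cauchy_Schwarz:
  fixes a b c :: real
  assumes "\<And>u v. 0 \<le> u\<^sup>2 * a + 2 * u * v * b + v\<^sup>2 * c"
  shows "b\<^sup>2 \<le> a * c"
proof (cases "a = 0")
  case True
  have "b = 0"
  proof (rule ccontr)
    assume "b \<noteq> 0"
    \<comment> \<open>For \<open>a = 0\<close> the form is linear in \<open>u\<close>; this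
      \<open>u\<close> is chosen to give it the value \<open>-1\<close>.\<close>
    have "0 \<le> (-(c + 1) / (2 * b))\<^sup>2 * a + 2 * (-(c + 1) / (2 * b)) * 1 * b + 1\<^sup>2 * c"
      by (rule assms)
    with True \<open>b \<noteq> 0\<close> show False
      by (simp add: field_simps)
  qed
  with True show ?thesis by simp
next
  case False
  have "0 \<le> a" using assms[of 1 0] by simp
  \<comment> \<open>At the point \<open>(-b, a)\<close> the form equals \<open>a\<close> times its
    determinant.\<close>
  have "0 \<le> (- b)\<^sup>2 * a + 2 * (- b) * a * b + a\<^sup>2 * c"
    by (rule assms)
  then have "0 \<le> a * (a * c - b\<^sup>2)"
    by (simp add: algebra_simps power2_eq_square)
  with False \<open>0 \<le> a\<close> show ?thesis
    by (simp add: zero_le_mult_iff)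
qed

text \<open>
  \<open>A, D, E\<close> are the entries of the Gram matrix of \<open>T\<eta>, T\<xi>\<close>, and \<open>p, p, P\<close> those of the Gram
  matrix of \<open>\<eta>, \<xi>\<close>, where \<open>\<eta>\<close> is an orthogonal projection of \<open>\<xi>\<close>. Since \<open>\<xi>\<close> almost attains the norm
  \<open>L\<close> of \<open>T\<close>, the form \<open>L\<^sup>2\<langle>x, y\<rangle> - \<langle>Tx, Ty\<rangle>\<close> almost vanishes at \<open>\<xi>\<close>, so \<open>D\<close> is close to \<open>L\<^sup>2p\<close>
  by Cauchy-Schwarz.
\<close>

lemma near_maximizer_projection_bound:
  fixes A D E L P p d e :: real
  assumes upper: "\<And>u v. u\<^sup>2 * A + 2 * u * v * D + v\<^sup>2 * E \<le> L\<^sup>2 * (u\<^sup>2 * p + 2 * u * v * p + v\<^sup>2 * P)"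
    and lower: "\<And>u v. 0 \<le> u\<^sup>2 * A + 2 * u * v * D + v\<^sup>2 * E"
    and near: "(1 - e\<^sup>2) * L\<^sup>2 * P \<le> E"
    and mass: "d\<^sup>2 * P \<le> p"
    and "0 < L" "0 < P" "0 \<le> e" "e \<le> d"
  shows "L\<^sup>2 * p * (d - e)\<^sup>2 \<le> A"
proof -
  define M where "M = L\<^sup>2"
  have "0 < M" using \<open>0 < L\<close> by (simp add: M_def)
  note upper = upper[folded M_def] and near = near[folded M_def]
  have p0: "0 \<le> p"
    using mass \<open>0 < P\<close> by (meson less_imp_le mult_nonneg_nonneg order_trans zero_le_power2)
  have A0: "0 \<le> A" using lower[of 1 0] by simp
  have "(M * p - D)\<^sup>2 \<le> (M * p - A) * (M * P - E)"
  proof (rule quadratic_form_Cauchy_Schwarz)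
    fix u v
    show "0 \<le> u\<^sup>2 * (M * p - A) + 2 * u * v * (M * p - D) + v\<^sup>2 * (M * P - E)"
      using upper[of u v] by (simp add: algebra_simps)
  qed
  also have "\<dots> \<le> (M * p) * (M * P * e\<^sup>2)"
  proof (rule mult_mono)
    show "M * P - E \<le> M * P * e\<^sup>2" using near by (simp add: algebra_simps)
  qed (use A0 p0 \<open>0 < M\<close> upper[of 0 1] in auto)
  also have "\<dots> = (M * sqrt p * sqrt P * e)\<^sup>2"
    using p0 \<open>0 < P\<close> by (simp add: power_mult_distrib power2_eq_square[of M])
  finally have "\<bar>M * p - D\<bar> \<le> \<bar>M * sqrt p * sqrt P * e\<bar>"
    by (simp only: abs_le_square_iff)
  also have "\<dots> = M * sqrt p * sqrt P * e"
    using \<open>0 \<le> e\<close> \<open>0 < P\<close> \<open>0 < M\<close> p0 by (intro abs_of_nonneg mult_nonneg_nonneg) auto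
  finally have "\<bar>M * p - D\<bar> \<le> M * sqrt p * sqrt P * e" .
  then have "M * p - M * sqrt p * sqrt P * e \<le> D" by linarith
  moreover have "M * p - M * sqrt p * sqrt P * e = M * sqrt p * (sqrt p - sqrt P * e)"
    using p0 by (simp add: algebra_simps)
  \<comment> \<open>The mass hypothesis, after taking roots, replaces
    \<open>sqrt p - e * sqrt P\<close> by a multiple of \<open>sqrt P\<close>. After squaring, a
    factor \<open>M * P\<close> appears on both sides and cancels.\<close>
  moreover have "d * sqrt P \<le> sqrt p"
    using real_sqrt_le_mono[OF mass] \<open>0 \<le> e\<close> \<open>e \<le> d\<close> by (simp add: real_sqrt_mult)
  then have "M * sqrt p * (sqrt P * (d - e)) \<le> M * sqrt p * (sqrt p - sqrt P * e)"
    using p0 \<open>0 < M\<close> by (intro mult_left_mono) (auto simp: algebra_simps)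
  ultimately have "M * sqrt p * (sqrt P * (d - e)) \<le> D" by linarith
  then have "(M * sqrt p * (sqrt P * (d - e)))\<^sup>2 \<le> D\<^sup>2"
    using p0 \<open>0 < P\<close> \<open>0 < M\<close> \<open>e \<le> d\<close> by (intro power_mono) auto
  \<comment> \<open>A second use of Cauchy-Schwarz, now for the form \<open><Tx,Ty>\<close> itself,
    turns the lower bound on \<open>D\<close> into one on \<open>A\<close>.\<close>
  also have "\<dots> \<le> A * E"
    by (rule quadratic_form_Cauchy_Schwarz) (use lower in auto)
  also have "\<dots> \<le> A * (M * P)"
    using upper[of 0 1] A0 by (intro mult_left_mono) auto
  finally have "(M * p * (d - e)\<^sup>2) * (M * P) \<le> A * (M * P)"
    using p0 \<open>0 < P\<close> by (simp add: power_mult_distrib power2_eq_square[of M] mult_ac)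
  then have "M * p * (d - e)\<^sup>2 \<le> A"
    by (rule mult_right_le_imp_le) (simp add: \<open>0 < M\<close> \<open>0 < P\<close>)
  then show ?thesis by (simp add: M_def)
qed

section \<open>Square-integrable functions and their restriction to measurable sets\<close>

text \<open>The orthogonal projection of \<open>L2\<close> onto the functions living on
  \<open>B\<close>. The indicator form makes measurability automatic; \<open>cutoff_apply\<close>
  recovers the pointwise form.\<close>

definition cutoff :: "'a set \<Rightarrow> ('a \<Rightarrow> 'h::real_vector) \<Rightarrow> 'a \<Rightarrow> 'h" where
  "cutoff B \<phi> = (\<lambda>x. indicat_real B x *\<^sub>R \<phi> x)"

lemma cutoff_apply: "cutoff B \<phi> x = (if x \<in> B then \<phi> x else 0)"
  by (simp add: cutoff_def)

lemma cutoff_Un: "A \<inter> B = {} \<Longrightarrow> cutoff (A \<union> B) \<phi> = (\<lambda>x. cutoff A \<phi> x + cutoff B \<phi> x)"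
  by (auto simp: cutoff_apply fun_eq_iff)

lemma L2_cutoff:
  fixes \<phi> :: "'a \<Rightarrow> 'h::{complex_inner, second_countable_topology}"
  assumes "\<phi> \<in> L2 \<nu>" "B \<in> sets \<nu>"
  shows "cutoff B \<phi> \<in> L2 \<nu>"
proof -
  have [measurable]: "\<phi> \<in> borel_measurable \<nu>" "B \<in> sets \<nu>" using assms by (auto simp: L2_def)
  have "integrable \<nu> (\<lambda>x. (norm (\<phi> x))\<^sup>2)" using assms by (simp add: L2_def)
  then have "integrable \<nu> (\<lambda>x. (norm (cutoff B \<phi> x))\<^sup>2)"
    by (rule Bochner_Integration.integrable_bound) (auto simp: cutoff_def indicator_def)
  then show ?thesis by (simp add: L2_def cutoff_def)
qed

lemma L2_scaleR:
  fixes \<phi> :: "'a \<Rightarrow> 'h::{complex_inner, second_countable_topology}"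
  assumes "\<phi> \<in> L2 \<nu>"
  shows "(\<lambda>x. u *\<^sub>R \<phi> x) \<in> L2 \<nu>"
  using assms by (auto simp: L2_def power_mult_distrib)

lemma L2_add:
  fixes \<phi> \<psi> :: "'a \<Rightarrow> 'h::{complex_inner, second_countable_topology}"
  assumes "\<phi> \<in> L2 \<nu>" "\<psi> \<in> L2 \<nu>"
  shows "(\<lambda>x. \<phi> x + \<psi> x) \<in> L2 \<nu>"
proof -
  have [measurable]: "\<phi> \<in> borel_measurable \<nu>" "\<psi> \<in> borel_measurable \<nu>"
    using assms by (auto simp: L2_def)
  have "integrable \<nu> (\<lambda>x. 2 * (norm (\<phi> x))\<^sup>2 + 2 * (norm (\<psi> x))\<^sup>2)"
    using assms by (auto simp: L2_def)
  then have "integrable \<nu> (\<lambda>x. (norm (\<phi> x + \<psi> x))\<^sup>2)"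
  proof (rule Bochner_Integration.integrable_bound)
    have "(norm (\<phi> x + \<psi> x))\<^sup>2 \<le> 2 * (norm (\<phi> x))\<^sup>2 + 2 * (norm (\<psi> x))\<^sup>2" for x
    proof -
      have "(norm (\<phi> x + \<psi> x))\<^sup>2 \<le> (norm (\<phi> x) + norm (\<psi> x))\<^sup>2"
        by (intro power_mono norm_triangle_ineq) auto
      also have "\<dots> \<le> 2 * (norm (\<phi> x))\<^sup>2 + 2 * (norm (\<psi> x))\<^sup>2"
        using sum_squares_bound[of "norm (\<phi> x)" "norm (\<psi> x)"] by (simp add: power2_sum)
      finally show ?thesis .
    qed
    then show "AE x in \<nu>. norm ((norm (\<phi> x + \<psi> x))\<^sup>2) \<le> norm (2 * (norm (\<phi> x))\<^sup>2 + 2 * (norm (\<psi> x))\<^sup>2)"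
      by (intro always_eventually allI) (simp add: abs_of_nonneg)
  qed measurable
  then show ?thesis by (simp add: L2_def)
qed

lemma norm_L2_nonneg: "0 \<le> norm_L2 \<nu> \<phi>"
  by (simp add: norm_L2_def)

lemma norm_L2_sq: "(norm_L2 \<nu> \<phi>)\<^sup>2 = (\<integral>x. (norm (\<phi> x))\<^sup>2 \<partial>\<nu>)"
  by (simp add: norm_L2_def)

lemma norm_L2_cong_AE:
  fixes \<phi> \<psi> :: "'a \<Rightarrow> 'h::complex_inner"
  assumes "\<phi> \<in> L2 \<nu>" "\<psi> \<in> L2 \<nu>" "AE x in \<nu>. \<phi> x = \<psi> x"
  shows "norm_L2 \<nu> \<phi> = norm_L2 \<nu> \<psi>"
proof -
  have [measurable]: "\<phi> \<in> borel_measurable \<nu>" "\<psi> \<in> borel_measurable \<nu>"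
    using assms by (auto simp: L2_def)
  show ?thesis
    unfolding norm_L2_def using assms(3) by (intro arg_cong[of _ _ sqrt] integral_cong_AE) auto
qed

lemma norm_L2_eq_0_iff:
  assumes "\<phi> \<in> L2 \<nu>"
  shows "norm_L2 \<nu> \<phi> = 0 \<longleftrightarrow> (AE x in \<nu>. \<phi> x = 0)"
  using integral_nonneg_eq_0_iff_AE[of \<nu> "\<lambda>x. (norm (\<phi> x))\<^sup>2"] assms
  by (simp add: norm_L2_def L2_def)

lemma norm_L2_scaleR: "norm_L2 \<nu> (\<lambda>x. u *\<^sub>R \<phi> x) = \<bar>u\<bar> * norm_L2 \<nu> \<phi>"
  by (simp add: norm_L2_def power_mult_distrib real_sqrt_mult)

lemma norm_L2_lincomb_sq:
  fixes \<phi> \<psi> :: "'a \<Rightarrow> 'h::{complex_inner, second_countable_topology}"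
  assumes "\<phi> \<in> L2 \<nu>" "\<psi> \<in> L2 \<nu>"
  shows "(norm_L2 \<nu> (\<lambda>x. u *\<^sub>R \<phi> x + v *\<^sub>R \<psi> x))\<^sup>2 =
    u\<^sup>2 * (norm_L2 \<nu> \<phi>)\<^sup>2 + v\<^sup>2 * (norm_L2 \<nu> \<psi>)\<^sup>2 +
    u * v * ((norm_L2 \<nu> (\<lambda>x. \<phi> x + \<psi> x))\<^sup>2 - (norm_L2 \<nu> \<phi>)\<^sup>2 - (norm_L2 \<nu> \<psi>)\<^sup>2)"
proof -
  have "integrable \<nu> (\<lambda>x. (norm (\<phi> x))\<^sup>2)" "integrable \<nu> (\<lambda>x. (norm (\<psi> x))\<^sup>2)"
    "integrable \<nu> (\<lambda>x. (norm (\<phi> x + \<psi> x))\<^sup>2)"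
    using assms L2_add[OF assms] by (auto simp: L2_def)
  then show ?thesis
    by (simp add: norm_L2_sq norm_scaleR_add_sq)
qed

text \<open>The dictionary between masses and norms. It lets countable additivity of a measure stand
  in for orthogonal series in \<open>L2\<close>.\<close>

lemma emeasure_density_norm_sq:
  fixes \<phi> :: "'a \<Rightarrow> 'h::{complex_inner, second_countable_topology}"
  assumes "\<phi> \<in> L2 \<nu>" "B \<in> sets \<nu>"
  shows "emeasure (density \<nu> (\<lambda>x. ennreal ((norm (\<phi> x))\<^sup>2))) B = ennreal ((norm_L2 \<nu> (cutoff B \<phi>))\<^sup>2)"
proof -
  have [measurable]: "\<phi> \<in> borel_measurable \<nu>" "B \<in> sets \<nu>" using assms by (auto simp: L2_def)
  have "emeasure (density \<nu> (\<lambda>x. ennreal ((norm (\<phi> x))\<^sup>2))) B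
      = (\<integral>\<^sup>+x. ennreal ((norm (\<phi> x))\<^sup>2) * indicator B x \<partial>\<nu>)"
    by (intro emeasure_density) auto
  also have "\<dots> = (\<integral>\<^sup>+x. ennreal ((norm (cutoff B \<phi> x))\<^sup>2) \<partial>\<nu>)"
    by (intro nn_integral_cong) (auto simp: cutoff_def indicator_def)
  also have "\<dots> = ennreal (\<integral>x. (norm (cutoff B \<phi> x))\<^sup>2 \<partial>\<nu>)"
    using L2_cutoff[OF assms] by (intro nn_integral_eq_integral) (auto simp: L2_def)
  finally show ?thesis by (simp add: norm_L2_sq)
qed

lemma norm_L2_cutoff_le:
  fixes \<phi> :: "'a \<Rightarrow> 'h::{complex_inner, second_countable_topology}"
  assumes "\<phi> \<in> L2 \<nu>" "A \<in> sets \<nu>" "B \<in> sets \<nu>" "A \<subseteq> B"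
  shows "norm_L2 \<nu> (cutoff A \<phi>) \<le> norm_L2 \<nu> (cutoff B \<phi>)"
  unfolding norm_L2_def
  using L2_cutoff[OF assms(1,2)] L2_cutoff[OF assms(1,3)] assms(4)
  by (intro real_sqrt_le_mono integral_mono) (auto simp: L2_def cutoff_def indicator_def)

section \<open>Bounded operators and functions almost attaining the norm\<close>

lemma bounded_operator_L2_in_L2: "bounded_operator_L2 \<nu> T \<Longrightarrow> \<phi> \<in> L2 \<nu> \<Longrightarrow> T \<phi> \<in> L2 \<nu>"
  by (simp add: bounded_operator_L2_def)

lemma bounded_operator_L2_add:
  "bounded_operator_L2 \<nu> T \<Longrightarrow> \<phi> \<in> L2 \<nu> \<Longrightarrow> \<psi> \<in> L2 \<nu> \<Longrightarrow>
    AE x in \<nu>. T (\<lambda>y. \<phi> y + \<psi> y) x = T \<phi> x + T \<psi> x"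
  by (simp add: bounded_operator_L2_def)

lemma bounded_operator_L2_scaleR:
  "bounded_operator_L2 \<nu> T \<Longrightarrow> \<phi> \<in> L2 \<nu> \<Longrightarrow> AE x in \<nu>. T (\<lambda>y. u *\<^sub>R \<phi> y) x = u *\<^sub>R T \<phi> x"
  by (simp add: bounded_operator_L2_def scaleR_scaleC)

lemma bounded_operator_L2_lincomb:
  fixes T :: "('a \<Rightarrow> 'h::{complex_inner, second_countable_topology}) \<Rightarrow> 'a \<Rightarrow> 'h"
  assumes "bounded_operator_L2 \<nu> T" "\<phi> \<in> L2 \<nu>" "\<psi> \<in> L2 \<nu>"
  shows "AE x in \<nu>. T (\<lambda>y. u *\<^sub>R \<phi> y + v *\<^sub>R \<psi> y) x = u *\<^sub>R T \<phi> x + v *\<^sub>R T \<psi> x"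
  using bounded_operator_L2_add[OF assms(1) L2_scaleR[OF assms(2)] L2_scaleR[OF assms(3)], of u v]
    bounded_operator_L2_scaleR[OF assms(1,2), of u] bounded_operator_L2_scaleR[OF assms(1,3), of v]
  by eventually_elim simp

text \<open>Rescaling to norm 1. The supremum over the reals is meaningful only for a bounded set,
  hence the detour through the constant \<open>K\<close>; functions of norm 0 cannot be rescaled,
  but \<open>K\<close> settles them directly.\<close>

lemma opnorm_L2_bound:
  fixes T :: "('a \<Rightarrow> 'h::{complex_inner, second_countable_topology}) \<Rightarrow> 'a \<Rightarrow> 'h"
  assumes T: "bounded_operator_L2 \<nu> T" and \<phi>: "\<phi> \<in> L2 \<nu>"
  shows "norm_L2 \<nu> (T \<phi>) \<le> opnorm_L2 \<nu> T * norm_L2 \<nu> \<phi>"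
proof -
  obtain K where K: "\<And>\<phi>. \<phi> \<in> L2 \<nu> \<Longrightarrow> norm_L2 \<nu> (T \<phi>) \<le> K * norm_L2 \<nu> \<phi>"
    using T unfolding bounded_operator_L2_def by blast
  show ?thesis
  proof (cases "norm_L2 \<nu> \<phi> = 0")
    case True
    then show ?thesis using K[OF \<phi>] by simp
  next
    case False
    define r where "r = norm_L2 \<nu> \<phi>"
    have r: "r > 0" using False norm_L2_nonneg[of \<nu> \<phi>] by (simp add: r_def)
    define \<psi> where "\<psi> = (\<lambda>x. (1 / r) *\<^sub>R \<phi> x)"
    have \<psi>: "\<psi> \<in> L2 \<nu>" unfolding \<psi>_def by (rule L2_scaleR[OF \<phi>])
    have "norm_L2 \<nu> \<psi> = 1"
      unfolding \<psi>_def norm_L2_scaleR using r by (simp add: r_def)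
    moreover have "bdd_above {norm_L2 \<nu> (T \<phi>) |\<phi>. \<phi> \<in> L2 \<nu> \<and> norm_L2 \<nu> \<phi> \<le> 1}"
    proof (rule bdd_aboveI)
      fix y assume "y \<in> {norm_L2 \<nu> (T \<phi>) |\<phi>. \<phi> \<in> L2 \<nu> \<and> norm_L2 \<nu> \<phi> \<le> 1}"
      then obtain \<phi> where "y = norm_L2 \<nu> (T \<phi>)" "\<phi> \<in> L2 \<nu>" "norm_L2 \<nu> \<phi> \<le> 1" by blast
      then have "y \<le> K * norm_L2 \<nu> \<phi>" using K by blast
      \<comment> \<open>The sign of \<open>K\<close> is unknown, hence the absolute value.\<close>
      also have "\<dots> \<le> \<bar>K\<bar> * 1"
        using \<open>norm_L2 \<nu> \<phi> \<le> 1\<close> norm_L2_nonneg[of \<nu> \<phi>] by (intro mult_mono) auto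
      finally show "y \<le> \<bar>K\<bar> * 1" .
    qed
    ultimately have "norm_L2 \<nu> (T \<psi>) \<le> opnorm_L2 \<nu> T"
      unfolding opnorm_L2_def using \<psi> by (intro cSup_upper) auto
    moreover have "norm_L2 \<nu> (T \<psi>) = norm_L2 \<nu> (\<lambda>x. (1 / r) *\<^sub>R T \<phi> x)"
      unfolding \<psi>_def
      by (intro norm_L2_cong_AE bounded_operator_L2_scaleR[OF T \<phi>] L2_scaleR
          bounded_operator_L2_in_L2[OF T] \<phi>)
    then have "norm_L2 \<nu> (T \<psi>) = norm_L2 \<nu> (T \<phi>) / r"
      unfolding norm_L2_scaleR using r by simp
    ultimately show ?thesis using r by (simp add: r_def field_simps)
  qed
qed

lemma zero_in_L2: "(\<lambda>x. 0) \<in> L2 \<nu>"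
  by (simp add: L2_def)

text \<open>Otherwise the supremum would be at most \<open>\<theta>\<close> times itself. The
  inequality is homogeneous in \<open>\<xi>\<close>, so no normalization is imposed; its strictness
  later excludes \<open>\<xi>\<close> of norm 0.\<close>

lemma opnorm_L2_near_maximizer:
  fixes T :: "('a \<Rightarrow> 'h::{complex_inner, second_countable_topology}) \<Rightarrow> 'a \<Rightarrow> 'h"
  assumes "0 < opnorm_L2 \<nu> T" "0 \<le> \<theta>" "\<theta> < 1"
  obtains \<xi> where "\<xi> \<in> L2 \<nu>" "\<theta> * opnorm_L2 \<nu> T * norm_L2 \<nu> \<xi> < norm_L2 \<nu> (T \<xi>)"
proof (rule ccontr)
  assume "\<not> thesis"
  with that have le: "norm_L2 \<nu> (T \<phi>) \<le> \<theta> * opnorm_L2 \<nu> T * norm_L2 \<nu> \<phi>" if "\<phi> \<in> L2 \<nu>" for \<phi>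
    using that by (meson not_less)
  have "Sup {norm_L2 \<nu> (T \<phi>) |\<phi>. \<phi> \<in> L2 \<nu> \<and> norm_L2 \<nu> \<phi> \<le> 1} \<le> \<theta> * opnorm_L2 \<nu> T"
  proof (rule cSup_least)
    have "norm_L2 \<nu> (\<lambda>x. 0 :: 'h) \<le> 1" by (simp add: norm_L2_def)
    with zero_in_L2[of \<nu>] show "{norm_L2 \<nu> (T \<phi>) |\<phi>. \<phi> \<in> L2 \<nu> \<and> norm_L2 \<nu> \<phi> \<le> 1} \<noteq> {}"
      by blast
    fix y assume "y \<in> {norm_L2 \<nu> (T \<phi>) |\<phi>. \<phi> \<in> L2 \<nu> \<and> norm_L2 \<nu> \<phi> \<le> 1}"
    then obtain \<phi> where \<phi>: "y = norm_L2 \<nu> (T \<phi>)" "\<phi> \<in> L2 \<nu>" "norm_L2 \<nu> \<phi> \<le> 1" by blast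
    have "y \<le> \<theta> * opnorm_L2 \<nu> T * norm_L2 \<nu> \<phi>" using le[OF \<phi>(2)] \<phi>(1) by simp
    also have "\<dots> \<le> \<theta> * opnorm_L2 \<nu> T * 1"
      using assms \<phi>(3) by (intro mult_left_mono) auto
    finally show "y \<le> \<theta> * opnorm_L2 \<nu> T" by simp
  qed
  then have "opnorm_L2 \<nu> T \<le> \<theta> * opnorm_L2 \<nu> T" by (fold opnorm_L2_def)
  with assms show False by simp
qed

text \<open>Cutting \<open>\<xi>\<close> down to \<open>B\<close> is an orthogonal projection, which gives the Gram matrix of \<open>1\<^sub>B\<xi>, \<xi>\<close>.\<close>

lemma norm_L2_cutoff_lincomb_sq:
  fixes \<xi> :: "'a \<Rightarrow> 'h::{complex_inner, second_countable_topology}"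
  assumes "\<xi> \<in> L2 \<nu>" "B \<in> sets \<nu>"
  shows "(norm_L2 \<nu> (\<lambda>x. u *\<^sub>R cutoff B \<xi> x + v *\<^sub>R \<xi> x))\<^sup>2 =
    u\<^sup>2 * (norm_L2 \<nu> (cutoff B \<xi>))\<^sup>2 + 2 * u * v * (norm_L2 \<nu> (cutoff B \<xi>))\<^sup>2 + v\<^sup>2 * (norm_L2 \<nu> \<xi>)\<^sup>2"
proof -
  have "integrable \<nu> (\<lambda>x. (norm (\<xi> x))\<^sup>2)" "integrable \<nu> (\<lambda>x. (norm (cutoff B \<xi> x))\<^sup>2)"
    using assms(1) L2_cutoff[OF assms] by (auto simp: L2_def)
  moreover have "(norm (u *\<^sub>R cutoff B \<xi> x + v *\<^sub>R \<xi> x))\<^sup>2 =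
      u\<^sup>2 * (norm (cutoff B \<xi> x))\<^sup>2 + 2 * u * v * (norm (cutoff B \<xi> x))\<^sup>2 + v\<^sup>2 * (norm (\<xi> x))\<^sup>2" for x
  proof (cases "x \<in> B")
    case True
    then have "(norm (u *\<^sub>R cutoff B \<xi> x + v *\<^sub>R \<xi> x))\<^sup>2 = (norm ((u + v) *\<^sub>R \<xi> x))\<^sup>2"
      by (simp add: cutoff_apply scaleR_add_left)
    also have "\<dots> = (u + v)\<^sup>2 * (norm (\<xi> x))\<^sup>2"
      by (simp add: power_mult_distrib)
    finally show ?thesis using True
      by (simp add: cutoff_apply power2_sum algebra_simps)
  qed (simp add: cutoff_apply power_mult_distrib)
  ultimately show ?thesis by (simp add: norm_L2_sq)
qed

text \<open>The hypotheses of \<open>near_maximizer_projection_bound\<close> hold because the Gram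
  form of \<open>T\<eta>, T\<xi>\<close> at \<open>(u, v)\<close> is the squared norm of
  \<open>T\<close> applied to \<open>u\<eta> + v\<xi>\<close>.\<close>

lemma norm_L2_operator_cutoff_ge:
  fixes T :: "('a \<Rightarrow> 'h::{complex_inner, second_countable_topology}) \<Rightarrow> 'a \<Rightarrow> 'h"
  assumes T: "bounded_operator_L2 \<nu> T" and \<xi>: "\<xi> \<in> L2 \<nu>" and B: "B \<in> sets \<nu>"
    and L: "0 < opnorm_L2 \<nu> T" and pos: "0 < norm_L2 \<nu> \<xi>"
    and near: "(1 - e\<^sup>2) * (opnorm_L2 \<nu> T)\<^sup>2 * (norm_L2 \<nu> \<xi>)\<^sup>2 \<le> (norm_L2 \<nu> (T \<xi>))\<^sup>2"
    and mass: "d\<^sup>2 * (norm_L2 \<nu> \<xi>)\<^sup>2 \<le> (norm_L2 \<nu> (cutoff B \<xi>))\<^sup>2"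
    and "0 \<le> e" "e \<le> d"
  shows "(opnorm_L2 \<nu> T)\<^sup>2 * (norm_L2 \<nu> (cutoff B \<xi>))\<^sup>2 * (d - e)\<^sup>2 \<le> (norm_L2 \<nu> (T (cutoff B \<xi>)))\<^sup>2"
proof -
  let ?\<eta> = "cutoff B \<xi>"
  note \<eta> = L2_cutoff[OF \<xi> B]
  note T\<eta> = bounded_operator_L2_in_L2[OF T \<eta>] and T\<xi> = bounded_operator_L2_in_L2[OF T \<xi>]
  \<comment> \<open>By polarization, the real part of the inner product of \<open>T\<eta>\<close>
    and \<open>T\<xi>\<close>.\<close>
  define D where "D = ((norm_L2 \<nu> (\<lambda>x. T ?\<eta> x + T \<xi> x))\<^sup>2 - (norm_L2 \<nu> (T ?\<eta>))\<^sup>2 - (norm_L2 \<nu> (T \<xi>))\<^sup>2) / 2"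
  have form: "u\<^sup>2 * (norm_L2 \<nu> (T ?\<eta>))\<^sup>2 + 2 * u * v * D + v\<^sup>2 * (norm_L2 \<nu> (T \<xi>))\<^sup>2
      = (norm_L2 \<nu> (\<lambda>x. u *\<^sub>R T ?\<eta> x + v *\<^sub>R T \<xi> x))\<^sup>2" for u v
    unfolding norm_L2_lincomb_sq[OF T\<eta> T\<xi>] D_def by simp
  show ?thesis
  proof (rule near_maximizer_projection_bound[where D = D])
    fix u v
    let ?\<zeta> = "\<lambda>x. u *\<^sub>R ?\<eta> x + v *\<^sub>R \<xi> x"
    have \<zeta>: "?\<zeta> \<in> L2 \<nu>" by (intro L2_add L2_scaleR \<eta> \<xi>)
    have "norm_L2 \<nu> (\<lambda>x. u *\<^sub>R T ?\<eta> x + v *\<^sub>R T \<xi> x) = norm_L2 \<nu> (T ?\<zeta>)"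
      using bounded_operator_L2_lincomb[OF T \<eta> \<xi>, of u v]
      by (intro norm_L2_cong_AE L2_add L2_scaleR T\<eta> T\<xi> bounded_operator_L2_in_L2[OF T \<zeta>]) auto
    also have "\<dots> \<le> opnorm_L2 \<nu> T * norm_L2 \<nu> ?\<zeta>"
      by (rule opnorm_L2_bound[OF T \<zeta>])
    finally have "(norm_L2 \<nu> (\<lambda>x. u *\<^sub>R T ?\<eta> x + v *\<^sub>R T \<xi> x))\<^sup>2 \<le> (opnorm_L2 \<nu> T * norm_L2 \<nu> ?\<zeta>)\<^sup>2"
      by (intro power_mono norm_L2_nonneg)
    then show "u\<^sup>2 * (norm_L2 \<nu> (T ?\<eta>))\<^sup>2 + 2 * u * v * D + v\<^sup>2 * (norm_L2 \<nu> (T \<xi>))\<^sup>2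
        \<le> (opnorm_L2 \<nu> T)\<^sup>2 * (u\<^sup>2 * (norm_L2 \<nu> ?\<eta>)\<^sup>2 + 2 * u * v * (norm_L2 \<nu> ?\<eta>)\<^sup>2 + v\<^sup>2 * (norm_L2 \<nu> \<xi>)\<^sup>2)"
      unfolding form power_mult_distrib norm_L2_cutoff_lincomb_sq[OF \<xi> B] .
    show "0 \<le> u\<^sup>2 * (norm_L2 \<nu> (T ?\<eta>))\<^sup>2 + 2 * u * v * D + v\<^sup>2 * (norm_L2 \<nu> (T \<xi>))\<^sup>2"
      unfolding form by simp
  qed (use assms in auto)
qed

section \<open>Diameters and distances of supports\<close>

lemma Supp_cutoff_subset: "Supp \<nu> (cutoff A \<phi>) \<subseteq> closure A"
proof -
  have "- closure A \<in> {U. open U \<and> (AE x in \<nu>. x \<in> U \<longrightarrow> cutoff A \<phi> x = 0)}"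
    using closure_subset[of A] by (auto simp: cutoff_apply)
  then show ?thesis unfolding Supp_def by blast
qed

text \<open>The support of a function cut off to a piece may leave the piece, but not its closure.
  Passing to the closure costs nothing in diameter, nor in distance as shown next.\<close>

lemma ediam_le_of_subset_closure:
  assumes "ediam A \<le> of_nat n" "S \<subseteq> closure A"
  shows "ediam S \<le> of_nat n"
proof -
  have A: "dist a b \<le> real n" if "a \<in> A" "b \<in> A" for a b
  proof -
    have "ennreal (dist a b) \<le> ediam A"
      unfolding ediam_def by (rule SUP_upper2[OF that(1) SUP_upper2[OF that(2) order_refl]])
    also have "\<dots> \<le> ennreal (real n)" using assms(1) by (simp add: ennreal_of_nat_eq_real_of_nat)
    finally show ?thesis by simp
  qed
  have "dist x y \<le> real n" if xy: "x \<in> closure A" "y \<in> closure A" for x y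
  proof (rule field_le_epsilon)
    fix e :: real assume "0 < e"
    then have "0 < e / 2" by simp
    then obtain a b where "a \<in> A" "dist a x < e / 2" "b \<in> A" "dist b y < e / 2"
      using xy unfolding closure_approachable by blast
    then show "dist x y \<le> real n + e"
      using A[of a b] dist_triangle[of x y a] dist_triangle[of a y b]
      by (simp add: dist_commute)
  qed
  with assms(2) show ?thesis
    unfolding ediam_def ennreal_of_nat_eq_real_of_nat
    by (intro SUP_least ennreal_leI) auto
qed

lemma set_edist_ge_of_subset_closure:
  assumes "\<And>a b. a \<in> A \<Longrightarrow> b \<in> B \<Longrightarrow> r \<le> dist a b" "S \<subseteq> closure A" "S' \<subseteq> closure B"
  shows "ennreal r \<le> set_edist S S'"
  unfolding set_edist_def
proof (intro INF_greatest ennreal_leI)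
  fix x y assume xy: "x \<in> S" "y \<in> S'"
  then have "x \<in> closure A" "y \<in> closure B" using assms by auto
  \<comment> \<open>\<open>setdist\<close> has the value 0 if a set is empty, so this case must be
    excluded before bounding it from below.\<close>
  then have "A \<noteq> {}" "B \<noteq> {}" by auto
  then have "r \<le> setdist A B" using assms(1) by (intro le_setdistI) auto
  also have "\<dots> = setdist (closure A) (closure B)" by simp
  also have "\<dots> \<le> dist x y" by (rule setdist_le_dist) fact+
  finally show "r \<le> dist x y" .
qed

section \<open>Neighbourhoods and operators of finite propagation\<close>

text \<open>A union of open balls is open, hence Borel, whatever \<open>A\<close> is; it also
  commutes with arbitrary unions.\<close>

definition nbhd :: "real \<Rightarrow> 'a::metric_space set \<Rightarrow> 'a set" where
  "nbhd r A = (\<Union>a\<in>A. ball a r)"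

lemma mem_nbhd: "x \<in> nbhd r A \<longleftrightarrow> (\<exists>a\<in>A. dist a x < r)"
  by (auto simp: nbhd_def)

lemma nbhd_Union: "nbhd r (\<Union>Q) = (\<Union>A\<in>Q. nbhd r A)"
  by (auto simp: nbhd_def)

lemma nbhd_borel: "nbhd r A \<in> sets borel"
  by (auto simp: nbhd_def intro!: borel_open open_UN)

lemma cinner_zero_right: "cinner x 0 = 0"
proof -
  have "cinner 0 x = 0"
    using cinner_add_left[of 0 0 x] by simp
  then show ?thesis
    by (subst cinner_commute) simp
qed

text \<open>The inner product of \<open>\<phi>\<close> with its own restriction to \<open>B\<close>
  is the squared norm of that restriction. This turns the orthogonality in the definition of
  propagation into pointwise vanishing.\<close>

lemma AE_zero_if_orthogonal_to_own_cutoff: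
  fixes \<phi> :: "'a \<Rightarrow> 'h::{complex_inner, second_countable_topology}"
  assumes "\<phi> \<in> L2 \<nu>" "B \<in> sets \<nu>" "cinner_L2 \<nu> \<phi> (cutoff B \<phi>) = 0"
  shows "AE x in \<nu>. x \<in> B \<longrightarrow> \<phi> x = 0"
proof -
  have "cinner (\<phi> x) (cutoff B \<phi> x) = complex_of_real ((norm (cutoff B \<phi> x))\<^sup>2)" for x
    by (simp add: cutoff_apply cinner_self cinner_zero_right)
  then have "complex_of_real (\<integral>x. (norm (cutoff B \<phi> x))\<^sup>2 \<partial>\<nu>) = 0"
    using assms(3) unfolding cinner_L2_def by (simp del: of_real_power)
  then have "norm_L2 \<nu> (cutoff B \<phi>) = 0"
    by (simp add: norm_L2_def)
  then have "AE x in \<nu>. cutoff B \<phi> x = 0"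
    using norm_L2_eq_0_iff[OF L2_cutoff[OF assms(1,2)]] by simp
  then show ?thesis by eventually_elim (auto simp: cutoff_apply)
qed

lemma cutoff_UNIV: "cutoff UNIV \<phi> = \<phi>"
  by (simp add: cutoff_def)

text \<open>The image is tested against its own restriction to the complement of the neighbourhood.
  Propagation speaks only about distances strictly larger than \<open>k\<close>; the radius
  \<open>k + 1\<close> provides this.\<close>

lemma propagation_cutoff_vanishes:
  fixes T :: "('a::metric_space \<Rightarrow> 'h::{complex_inner, second_countable_topology}) \<Rightarrow> 'a \<Rightarrow> 'h"
  assumes T: "T \<in> propagation_ops (real k) \<nu>" and sets: "sets \<nu> = sets borel"
    and \<phi>: "\<phi> \<in> L2 \<nu>" and A: "A \<in> sets borel"
  shows "AE x in \<nu>. x \<notin> nbhd (real k + 1) A \<longrightarrow> T (cutoff A \<phi>) x = 0"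
proof -
  let ?B = "- nbhd (real k + 1) A" and ?\<tau> = "T (cutoff A \<phi>)"
  have cut: "cutoff A \<phi> \<in> L2 \<nu>" using L2_cutoff[OF \<phi>] A sets by simp
  have \<tau>: "?\<tau> \<in> L2 \<nu>" using T cut by (simp add: propagation_ops_def bounded_operator_L2_def)
  have B: "?B \<in> sets \<nu>" using nbhd_borel[of "real k + 1" A] sets by auto
  have "ennreal (real k) < ennreal (real k + 1)" by (simp add: ennreal_less_iff)
  also have "\<dots> \<le> set_edist (Supp \<nu> (cutoff A \<phi>)) (Supp \<nu> (cutoff ?B ?\<tau>))"
    by (rule set_edist_ge_of_subset_closure[OF _ Supp_cutoff_subset Supp_cutoff_subset])
      (auto simp: mem_nbhd not_less)
  finally have "cinner_L2 \<nu> ?\<tau> (cutoff ?B ?\<tau>) = 0"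
    using T cut L2_cutoff[OF \<tau> B] by (simp add: propagation_ops_def)
  from AE_zero_if_orthogonal_to_own_cutoff[OF \<tau> B this] show ?thesis by simp
qed

text \<open>The empty set has infinite distance from every set, so \<open>T \<phi>\<close> is
  orthogonal to itself. A function with empty support need not vanish almost everywhere, which is
  why this is stated for \<open>T \<phi>\<close>.\<close>

lemma propagation_empty_Supp:
  fixes T :: "('a::metric_space \<Rightarrow> 'h::{complex_inner, second_countable_topology}) \<Rightarrow> 'a \<Rightarrow> 'h"
  assumes T: "T \<in> propagation_ops r \<nu>" and sets: "sets \<nu> = sets borel"
    and \<phi>: "\<phi> \<in> L2 \<nu>" and "Supp \<nu> \<phi> = {}"
  shows "AE x in \<nu>. T \<phi> x = 0"
proof -
  have \<tau>: "T \<phi> \<in> L2 \<nu>" using T \<phi> by (simp add: propagation_ops_def bounded_operator_L2_def)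
  have "ennreal r < set_edist (Supp \<nu> \<phi>) (Supp \<nu> (T \<phi>))"
    using assms by (simp add: set_edist_def)
  then have "cinner_L2 \<nu> (T \<phi>) (cutoff UNIV (T \<phi>)) = 0"
    using T \<phi> \<tau> by (simp add: propagation_ops_def cutoff_UNIV)
  from AE_zero_if_orthogonal_to_own_cutoff[OF \<tau> _ this] show ?thesis using sets by simp
qed

text \<open>
  Separation by \<open>2k + 3\<close> keeps the \<open>(k + 1)\<close>-neighbourhoods of the pieces disjoint, so \<open>T\<close> acts on
  the pieces independently.
\<close>

lemma norm_L2_operator_separated_Union_le:
  fixes T :: "('a::metric_space \<Rightarrow> 'h::{complex_inner, second_countable_topology}) \<Rightarrow> 'a \<Rightarrow> 'h"
  assumes T: "T \<in> propagation_ops (real k) \<nu>" and sets: "sets \<nu> = sets borel"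
    and \<xi>: "\<xi> \<in> L2 \<nu>" and Q: "countable Q" "\<And>A. A \<in> Q \<Longrightarrow> A \<in> sets borel"
    and sep: "\<And>A B a b. A \<in> Q \<Longrightarrow> B \<in> Q \<Longrightarrow> A \<noteq> B \<Longrightarrow> a \<in> A \<Longrightarrow> b \<in> B \<Longrightarrow> real (2 * k + 3) \<le> dist a b"
    and K: "0 \<le> K" "\<And>A. A \<in> Q \<Longrightarrow> (norm_L2 \<nu> (T (cutoff A \<xi>)))\<^sup>2 \<le> K * (norm_L2 \<nu> (cutoff A \<xi>))\<^sup>2"
  shows "(norm_L2 \<nu> (T (cutoff (\<Union>Q) \<xi>)))\<^sup>2 \<le> K * (norm_L2 \<nu> (cutoff (\<Union>Q) \<xi>))\<^sup>2"
proof -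
  define N :: "'a set \<Rightarrow> 'a set" where "N = nbhd (real k + 1)"
  define \<tau> where "\<tau> = T (cutoff (\<Union>Q) \<xi>)"
  have bT: "bounded_operator_L2 \<nu> T" using T by (simp add: propagation_ops_def)
  have UQ: "\<Union>Q \<in> sets borel" using Q by (intro sets.countable_Union) auto
  have cut: "cutoff B \<xi> \<in> L2 \<nu>" if "B \<in> sets borel" for B
    using L2_cutoff[OF \<xi>] that sets by simp
  have \<tau>: "\<tau> \<in> L2 \<nu>" unfolding \<tau>_def by (intro bounded_operator_L2_in_L2[OF bT] cut UQ)
  have N: "N A \<in> sets \<nu>" for A using nbhd_borel sets by (simp add: N_def)
  have N_Union: "N (\<Union>Q) = (\<Union>A\<in>Q. N A)" by (simp add: N_def nbhd_Union)
  have disj: "N A \<inter> N B = {}" if "\<And>a b. a \<in> A \<Longrightarrow> b \<in> B \<Longrightarrow> real (2 * k + 3) \<le> dist a b" for A B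
  proof (rule ccontr)
    assume "N A \<inter> N B \<noteq> {}"
    then obtain x a b where "a \<in> A" "b \<in> B" "dist a x < real k + 1" "dist b x < real k + 1"
      by (auto simp: N_def mem_nbhd)
    \<comment> \<open>The two radii add up to \<open>2k + 2\<close>, less than the
      separation.\<close>
    then show False using that[of a b] dist_triangle2[of a b x] by simp
  qed
  have piece: "(norm_L2 \<nu> (cutoff (N A) \<tau>))\<^sup>2 \<le> K * (norm_L2 \<nu> (cutoff A \<xi>))\<^sup>2" if A: "A \<in> Q" for A
  proof -
    \<comment> \<open>All other pieces are lumped into one set, so additivity of \<open>T\<close> is
      used for two summands only, even if \<open>Q\<close> is infinite. On \<open>N A\<close> the
      image of the second summand vanishes.\<close>
    let ?R = "\<Union>(Q - {A})"
    have R: "?R \<in> sets borel" using Q by (intro sets.countable_Union) auto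
    note TA = bounded_operator_L2_in_L2[OF bT cut[OF Q(2)[OF A]]]
    have "A \<inter> ?R = {}" using sep[OF A] by fastforce
    moreover have "\<Union>Q = A \<union> ?R" using A by auto
    ultimately have "cutoff (\<Union>Q) \<xi> = (\<lambda>x. cutoff A \<xi> x + cutoff ?R \<xi> x)"
      by (metis cutoff_Un)
    then have "AE x in \<nu>. \<tau> x = T (cutoff A \<xi>) x + T (cutoff ?R \<xi>) x"
      using bounded_operator_L2_add[OF bT cut[OF Q(2)[OF A]] cut[OF R]] by (simp add: \<tau>_def)
    moreover have "AE x in \<nu>. x \<notin> N ?R \<longrightarrow> T (cutoff ?R \<xi>) x = 0"
      unfolding N_def by (rule propagation_cutoff_vanishes[OF T sets \<xi> R])
    ultimately have "AE x in \<nu>. cutoff (N A) \<tau> x = cutoff (N A) (T (cutoff A \<xi>)) x"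
    proof eventually_elim
      case (elim x)
      have "N A \<inter> N ?R = {}" using sep[OF A] by (intro disj) auto
      with elim show ?case by (auto simp: cutoff_apply)
    qed
    then have "norm_L2 \<nu> (cutoff (N A) \<tau>) = norm_L2 \<nu> (cutoff (N A) (T (cutoff A \<xi>)))"
      by (intro norm_L2_cong_AE L2_cutoff N \<tau> TA)
    also have "\<dots> \<le> norm_L2 \<nu> (cutoff UNIV (T (cutoff A \<xi>)))"
      using N TA sets by (intro norm_L2_cutoff_le) auto
    finally have "(norm_L2 \<nu> (cutoff (N A) \<tau>))\<^sup>2 \<le> (norm_L2 \<nu> (T (cutoff A \<xi>)))\<^sup>2"
      by (intro power_mono norm_L2_nonneg) (simp add: cutoff_UNIV)
    also have "\<dots> \<le> K * (norm_L2 \<nu> (cutoff A \<xi>))\<^sup>2" by (rule K(2)[OF A])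
    finally show ?thesis .
  qed
  \<comment> \<open>The squared norm of \<open>\<tau>\<close> is thus its mass on the disjoint union
    of the sets \<open>N A\<close>. Countable additivity on both sides reduces the claim to the
    termwise bound \<open>piece\<close>.\<close>
  have "AE x in \<nu>. \<tau> x = cutoff (N (\<Union>Q)) \<tau> x"
    using propagation_cutoff_vanishes[OF T sets \<xi> UQ]
    by eventually_elim (auto simp: cutoff_apply \<tau>_def N_def)
  then have "norm_L2 \<nu> \<tau> = norm_L2 \<nu> (cutoff (N (\<Union>Q)) \<tau>)"
    by (intro norm_L2_cong_AE L2_cutoff N \<tau>)
  then have "ennreal ((norm_L2 \<nu> \<tau>)\<^sup>2) =
      emeasure (density \<nu> (\<lambda>x. ennreal ((norm (\<tau> x))\<^sup>2))) (\<Union>A\<in>Q. N A)"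
    by (simp add: emeasure_density_norm_sq[OF \<tau> N] flip: N_Union)
  also have "\<dots> = (\<integral>\<^sup>+A. emeasure (density \<nu> (\<lambda>x. ennreal ((norm (\<tau> x))\<^sup>2))) (N A) \<partial>count_space Q)"
  proof (rule emeasure_UN_countable)
    show "disjoint_family_on N Q"
      unfolding disjoint_family_on_def using sep by (intro ballI impI disj) auto
  qed (use N Q in auto)
  also have "\<dots> \<le> (\<integral>\<^sup>+A. ennreal K *
      emeasure (density \<nu> (\<lambda>x. ennreal ((norm (\<xi> x))\<^sup>2))) A \<partial>count_space Q)"
    using piece Q(2) sets K(1)
    by (intro nn_integral_mono)
      (auto simp: emeasure_density_norm_sq[OF \<tau> N] emeasure_density_norm_sq[OF \<xi>]
        simp flip: ennreal_mult intro!: ennreal_leI)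
  also have "\<dots> = ennreal K * (\<integral>\<^sup>+A. emeasure (density \<nu> (\<lambda>x. ennreal ((norm (\<xi> x))\<^sup>2))) A \<partial>count_space Q)"
    by (rule nn_integral_cmult) simp
  also have "(\<integral>\<^sup>+A. emeasure (density \<nu> (\<lambda>x. ennreal ((norm (\<xi> x))\<^sup>2))) A \<partial>count_space Q)
      = emeasure (density \<nu> (\<lambda>x. ennreal ((norm (\<xi> x))\<^sup>2))) (\<Union>A\<in>Q. A)"
  proof (rule emeasure_UN_countable[symmetric])
    show "disjoint_family_on (\<lambda>A. A) Q"
      unfolding disjoint_family_on_def using sep by fastforce
  qed (use Q sets in auto)
  also have "ennreal K * \<dots> = ennreal (K * (norm_L2 \<nu> (cutoff (\<Union>Q) \<xi>))\<^sup>2)"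
    using UQ sets K(1) by (simp add: emeasure_density_norm_sq[OF \<xi>] ennreal_mult)
  finally show ?thesis
    using K(1) by (simp add: \<tau>_def ennreal_le_iff)
qed

section \<open>Sparse decompositions with countably many pieces of positive mass\<close>

text \<open>
  On a non-separable space the pieces may be uncountable in number and need not capture the
  mass of \<open>\<Omega>\<close> (real-valued measurable cardinals). The union \<open>Z\<close> of the null pieces can then have
  positive mass, but it is locally null, so functions living on it have empty support.
\<close>

lemma sparse_decomposition:
  fixes \<xi> :: "'a::metric_space \<Rightarrow> 'h::{complex_inner, second_countable_topology}"
  assumes MS: "\<forall>\<mu> :: 'a measure. finite_measure \<mu> \<and> sets \<mu> = sets borel \<longrightarrow>
      (\<exists>\<Omega> P. \<Omega> \<in> sets borel \<and> \<Omega> = \<Union>P \<and> disjoint P \<and>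
        (\<forall>A\<in>P. \<forall>B\<in>P. A \<noteq> B \<longrightarrow> set_edist A B \<ge> of_nat m) \<and>
        (\<forall>A\<in>P. ediam A \<le> of_nat n) \<and>
        measure \<mu> \<Omega> \<ge> c * measure \<mu> UNIV)"
    and m: "1 \<le> m" and sets: "sets \<nu> = sets borel" and \<xi>: "\<xi> \<in> L2 \<nu>"
  obtains Q Z where "countable Q" "\<And>A. A \<in> Q \<Longrightarrow> A \<in> sets borel" "Z \<in> sets borel" "\<Union>Q \<inter> Z = {}"
    "\<And>A B a b. A \<in> Q \<Longrightarrow> B \<in> Q \<Longrightarrow> A \<noteq> B \<Longrightarrow> a \<in> A \<Longrightarrow> b \<in> B \<Longrightarrow> real m \<le> dist a b"
    "\<And>A. A \<in> Q \<Longrightarrow> ediam A \<le> of_nat n"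
    "\<And>A. A \<in> Q \<Longrightarrow> \<not> (AE x in \<nu>. cutoff A \<xi> x = 0)"
    "Supp \<nu> (cutoff Z \<xi>) = {}"
    "c * (norm_L2 \<nu> \<xi>)\<^sup>2 \<le> (norm_L2 \<nu> (cutoff (\<Union>Q \<union> Z) \<xi>))\<^sup>2"
proof -
  define \<mu> where "\<mu> = density \<nu> (\<lambda>x. ennreal ((norm (\<xi> x))\<^sup>2))"
  have sets_\<mu>: "sets \<mu> = sets borel" by (simp add: \<mu>_def sets)
  have em: "emeasure \<mu> A = ennreal ((norm_L2 \<nu> (cutoff A \<xi>))\<^sup>2)" if "A \<in> sets borel" for A
    unfolding \<mu>_def using that sets by (intro emeasure_density_norm_sq[OF \<xi>]) simp
  then have me: "measure \<mu> A = (norm_L2 \<nu> (cutoff A \<xi>))\<^sup>2" if "A \<in> sets borel" for A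
    using that by (simp add: measure_def)
  have "space \<mu> = UNIV" using sets_eq_imp_space_eq[OF sets_\<mu>] by simp
  then have "finite_measure \<mu>" by (intro finite_measureI) (simp add: em)
  then interpret finite_measure \<mu> .
  obtain \<Omega> P where \<Omega>: "\<Omega> \<in> sets borel" "\<Omega> = \<Union>P" "disjoint P"
    and sep': "\<And>A B. A \<in> P \<Longrightarrow> B \<in> P \<Longrightarrow> A \<noteq> B \<Longrightarrow> set_edist A B \<ge> of_nat m"
    and diam: "\<And>A. A \<in> P \<Longrightarrow> ediam A \<le> of_nat n"
    and mass: "measure \<mu> \<Omega> \<ge> c * measure \<mu> UNIV"
    using MS[THEN spec, THEN mp, OF conjI, OF finite_measure_axioms sets_\<mu>] by metis
  have sep: "real m \<le> dist a b" if "A \<in> P" "B \<in> P" "A \<noteq> B" "a \<in> A" "b \<in> B" for A B a b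
  proof -
    have "ennreal (real m) \<le> set_edist A B"
      using sep'[OF that(1-3)] by (simp add: ennreal_of_nat_eq_real_of_nat)
    also have "\<dots> \<le> ennreal (dist a b)"
      unfolding set_edist_def by (rule INF_lower2[OF that(4) INF_lower2[OF that(5) order_refl]])
    finally show ?thesis by simp
  qed
  \<comment> \<open>The pieces are not assumed to be Borel. As they are at distance at least 1 from
    each other, every union of pieces, even an uncountable one, is relatively open in
    \<open>\<Omega>\<close>.\<close>
  have sub: "\<Union>R \<in> sets borel" if R: "R \<subseteq> P" for R
  proof -
    have "\<Union>R = \<Omega> \<inter> nbhd 1 (\<Union>R)"
    proof (intro equalityI subsetI)
      fix x assume "x \<in> \<Omega> \<inter> nbhd 1 (\<Union>R)"
      then obtain A B a where "x \<in> B" "B \<in> P" "a \<in> A" "A \<in> R" "dist a x < 1"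
        using \<Omega>(2) by (auto simp: mem_nbhd)
      moreover from this have "A = B" using sep[of A B a x] R m by (cases "A = B") auto
      ultimately show "x \<in> \<Union>R" by blast
    next
      fix x assume "x \<in> \<Union>R"
      moreover from this have "x \<in> nbhd 1 (\<Union>R)" unfolding mem_nbhd by (intro bexI[of _ x]) simp_all
      ultimately show "x \<in> \<Omega> \<inter> nbhd 1 (\<Union>R)" using R \<Omega>(2) by blast
    qed
    then show ?thesis using \<Omega>(1) nbhd_borel by (metis sets.Int)
  qed
  have P: "A \<in> sets borel" if "A \<in> P" for A
    using sub[of "{A}"] that by simp
  define Q where "Q = {A\<in>P. measure \<mu> A \<noteq> 0}"
  define Z where "Z = \<Union>(P - Q)"
  have Un: "\<Union>Q \<union> Z = \<Omega>" unfolding Z_def \<Omega>(2) Q_def by auto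
  have "countable Q"
  proof -
    \<comment> \<open>Finitely many disjoint pieces have total mass at most that of the space, so
      the family of masses is summable and only countably many are nonzero.\<close>
    have "(\<lambda>A. measure \<mu> A) summable_on P"
    proof (rule nonneg_bdd_above_summable_on)
      show "bdd_above (sum (measure \<mu>) ` {F. F \<subseteq> P \<and> finite F})"
      proof (rule bdd_aboveI2)
        fix F assume "F \<in> {F. F \<subseteq> P \<and> finite F}"
        then have F: "F \<subseteq> P" "finite F" by auto
        have "disjoint F" using \<Omega>(3) F(1) by (rule pairwise_subset)
        then have "sum (measure \<mu>) F = measure \<mu> (\<Union>A\<in>F. A)"
          using F P sets_\<mu> by (intro finite_measure_finite_Union[symmetric])
            (auto simp: disjoint_family_on_def pairwise_def disjnt_def)
        also have "\<dots> \<le> measure \<mu> (space \<mu>)" by (rule bounded_measure)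
        finally show "sum (measure \<mu>) F \<le> measure \<mu> (space \<mu>)" .
      qed
    qed simp
    then show ?thesis unfolding Q_def by (rule summable_countable_real)
  qed
  moreover have "A \<in> sets borel" if "A \<in> Q" for A using that P by (simp add: Q_def)
  moreover have "Z \<in> sets borel" unfolding Z_def by (rule sub) auto
  moreover have "\<Union>Q \<inter> Z = {}"
    using \<Omega>(3) by (fastforce simp: Z_def Q_def pairwise_def disjnt_def)
  moreover have "real m \<le> dist a b" if "A \<in> Q" "B \<in> Q" "A \<noteq> B" "a \<in> A" "b \<in> B" for A B a b
    using that sep by (auto simp: Q_def)
  moreover have "ediam A \<le> of_nat n" if "A \<in> Q" for A
    using that diam by (simp add: Q_def)
  moreover have null_iff: "measure \<mu> A = 0 \<longleftrightarrow> (AE x in \<nu>. cutoff A \<xi> x = 0)" if "A \<in> P" for A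
    using norm_L2_eq_0_iff[OF L2_cutoff[OF \<xi>]] P[OF that] me sets by simp
  then have "\<not> (AE x in \<nu>. cutoff A \<xi> x = 0)" if "A \<in> Q" for A
    using that unfolding Q_def by blast
  moreover have "Supp \<nu> (cutoff Z \<xi>) = {}"
  proof -
    \<comment> \<open>Two points of such a ball are less than 1 apart, so it meets at most one of
      the pieces forming \<open>Z\<close>, and that piece is null.\<close>
    have "AE y in \<nu>. y \<in> ball x (1/2) \<longrightarrow> cutoff Z \<xi> y = 0" for x
    proof (cases "ball x (1/2) \<inter> Z = {}")
      case True
      then show ?thesis by (intro AE_I2) (auto simp: cutoff_apply disjoint_iff)
    next
      case False
      then obtain z A where zA: "z \<in> A" "A \<in> P" "A \<notin> Q" "dist x z < 1/2"
        by (auto simp: Z_def)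
      have ZA: "y \<in> A" if y: "y \<in> Z" "dist x y < 1/2" for y
      proof -
        obtain B where "y \<in> B" "B \<in> P" using y(1) by (auto simp: Z_def)
        moreover have "dist z y < 1"
          using y zA dist_triangle3[of z y x] by simp
        ultimately show ?thesis using sep[of A B z y] zA m by (cases "A = B") auto
      qed
      have "AE y in \<nu>. cutoff A \<xi> y = 0"
        using null_iff[OF zA(2)] zA by (simp add: Q_def)
      then show ?thesis
        by eventually_elim (use ZA in \<open>auto simp: cutoff_apply split: if_splits\<close>)
    qed
    then have "x \<in> \<Union>{U. open U \<and> (AE y in \<nu>. y \<in> U \<longrightarrow> cutoff Z \<xi> y = 0)}" for x
      by (intro UnionI[of "ball x (1/2)"]) auto
    then show ?thesis unfolding Supp_def by blast
  qed
  moreover have "c * (norm_L2 \<nu> \<xi>)\<^sup>2 \<le> (norm_L2 \<nu> (cutoff (\<Union>Q \<union> Z) \<xi>))\<^sup>2"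
    using mass \<Omega>(1) by (simp add: Un me cutoff_UNIV)
  ultimately show thesis by (rule that)
qed

section \<open>From sparsification to norm localization\<close>

text \<open>The witness is a constant nonzero vector on a ball. Countably many balls cover the
  space, so one has positive measure, and local finiteness makes it finite.\<close>

lemma exists_nonzero_L2:
  fixes \<nu> :: "'a::metric_space measure"
    and H :: "'h::{complex_inner, second_countable_topology} itself"
  assumes \<nu>: "locally_finite_borel_measure \<nu>" and pos: "emeasure \<nu> UNIV \<noteq> 0"
    and inf: "infinite_dimensional H"
  obtains \<xi> :: "'a \<Rightarrow> 'h" where "\<xi> \<in> L2 \<nu>" "\<not> (AE x in \<nu>. \<xi> x = 0)"
proof -
  have sets: "sets \<nu> = sets borel" using \<nu> by (simp add: locally_finite_borel_measure_def)
  have space: "space \<nu> = UNIV" using sets_eq_imp_space_eq[OF sets] by simp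
  obtain h :: 'h where h: "h \<noteq> 0"
  proof (rule ccontr)
    assume "\<not> thesis"
    then have "UNIV = {0 :: 'h}" using that by auto
    then have "module.span scaleC ({} :: 'h set) = UNIV" by simp
    with inf show False unfolding infinite_dimensional_def by blast
  qed
  obtain x0 :: 'a where True by simp
  have "\<exists>n. emeasure \<nu> (ball x0 (real n)) \<noteq> 0"
  proof (rule ccontr)
    assume "\<not> ?thesis"
    then have "emeasure \<nu> (\<Union>n. ball x0 (real n)) = 0"
      using sets by (intro emeasure_UN_eq_0) auto
    moreover have "(\<Union>n. ball x0 (real n)) = UNIV"
      using reals_Archimedean2 by (auto simp: set_eq_iff)
    ultimately show False using pos by simp
  qed
  then obtain n where n: "emeasure \<nu> (ball x0 (real n)) \<noteq> 0" by blast
  let ?B = "ball x0 (real n)"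
  have B: "?B \<in> sets \<nu>" using sets by simp
  have fin: "emeasure \<nu> ?B < \<infinity>"
    using \<nu> by (auto simp: locally_finite_borel_measure_def)
  have "cutoff ?B (\<lambda>_. h) \<in> L2 \<nu>"
  proof -
    have "(\<lambda>x. (norm (cutoff ?B (\<lambda>_. h) x))\<^sup>2) = (\<lambda>x. indicat_real ?B x * (norm h)\<^sup>2)"
      by (auto simp: cutoff_apply fun_eq_iff)
    then show ?thesis
      using B fin by (simp add: L2_def) (simp add: cutoff_def)
  qed
  moreover have "\<not> (AE x in \<nu>. cutoff ?B (\<lambda>_. h) x = 0)"
  proof
    assume "AE x in \<nu>. cutoff ?B (\<lambda>_. h) x = 0"
    then have "AE x in \<nu>. x \<notin> ?B" by eventually_elim (use h in \<open>auto simp: cutoff_apply split: if_splits\<close>)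
    then have "emeasure \<nu> ?B = 0" by (subst (asm) AE_iff_measurable[OF B]) (auto simp: space)
    with n show False by contradiction
  qed
  ultimately show thesis by (rule that)
qed

text \<open>The gap between \<open>c'\<close> and \<open>sqrt c\<close> pays for
  \<open>\<xi>\<close> attaining the norm of \<open>T\<close> only approximately.\<close>

lemma sparsification_imp_localization:
  fixes X :: "'a::metric_space itself"
    and H :: "'h::{complex_inner, second_countable_topology} itself"
  assumes inf: "infinite_dimensional H"
    and MS: "metric_sparsification X c"
    and c': "0 < c'" "c' < sqrt c"
  shows "operator_norm_localization X H c'"
proof -
  obtain f :: "nat \<Rightarrow> nat" where f: "mono f" and c: "0 < c" "c \<le> 1"
    and sparse: "\<forall>m. \<forall>\<mu> :: 'a measure. finite_measure \<mu> \<and> sets \<mu> = sets borel \<longrightarrow>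
         (\<exists>\<Omega> P. \<Omega> \<in> sets borel \<and> \<Omega> = \<Union>P \<and> disjoint P \<and>
            (\<forall>A\<in>P. \<forall>B\<in>P. A \<noteq> B \<longrightarrow> set_edist A B \<ge> of_nat m) \<and>
            (\<forall>A\<in>P. ediam A \<le> of_nat (f m)) \<and>
            measure \<mu> \<Omega> \<ge> c * measure \<mu> UNIV)"
    using MS unfolding metric_sparsification_def by (elim conjE exE) (rule that)
  have "sqrt c \<le> 1" using c by simp
  have "\<exists>\<phi> :: 'a \<Rightarrow> 'h. \<phi> \<in> L2 \<nu> \<and> \<not> (AE x in \<nu>. \<phi> x = 0) \<and>
             ediam (Supp \<nu> \<phi>) \<le> of_nat (f (2 * k + 3)) \<and>
             norm_L2 \<nu> (T \<phi>) \<ge> c' * opnorm_L2 \<nu> T * norm_L2 \<nu> \<phi>"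
    if \<nu>: "locally_finite_borel_measure \<nu>" "emeasure \<nu> UNIV \<noteq> 0"
      and T: "T \<in> propagation_ops (real k) \<nu>" for \<nu> :: "'a measure" and k and T :: "('a \<Rightarrow> 'h) \<Rightarrow> 'a \<Rightarrow> 'h"
  proof -
    define L where "L = opnorm_L2 \<nu> T"
    have sets: "sets \<nu> = sets borel" using \<nu> by (simp add: locally_finite_borel_measure_def)
    have bT: "bounded_operator_L2 \<nu> T" using T by (simp add: propagation_ops_def)
    obtain \<xi>0 :: "'a \<Rightarrow> 'h" where \<xi>0: "\<xi>0 \<in> L2 \<nu>" "\<not> (AE x in \<nu>. \<xi>0 x = 0)"
      using exists_nonzero_L2[OF \<nu> inf] .
    then have "0 < norm_L2 \<nu> \<xi>0"
      using norm_L2_eq_0_iff[OF \<xi>0(1)] norm_L2_nonneg[of \<nu> \<xi>0] by linarith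
    with opnorm_L2_bound[OF bT \<xi>0(1)] norm_L2_nonneg[of \<nu> "T \<xi>0"] have "0 \<le> L"
      unfolding L_def by (smt (verit) mult_neg_pos)
    \<comment> \<open>Half the gap: the loss \<open>e\<close> in the lower bound for the restriction
      to \<open>\<Omega>\<close> still leaves a constant above \<open>c'\<close>.\<close>
    define e where "e = (sqrt c - c') / 2"
    have e: "0 < e" "e < 1" "e \<le> sqrt c" "c' < sqrt c - e"
    proof -
      have "2 * e = sqrt c - c'" by (simp add: e_def)
      then show "0 < e" "e < 1" "e \<le> sqrt c" "c' < sqrt c - e"
        using c' \<open>sqrt c \<le> 1\<close> by linarith+
    qed
    have e2: "0 \<le> 1 - e\<^sup>2" "1 - e\<^sup>2 < 1" using e by (auto simp: power_le_one)
    have "\<exists>\<xi>\<in>L2 \<nu>. 0 < norm_L2 \<nu> \<xi> \<and> (1 - e\<^sup>2) * L\<^sup>2 * (norm_L2 \<nu> \<xi>)\<^sup>2 \<le> (norm_L2 \<nu> (T \<xi>))\<^sup>2"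
    proof (cases "L = 0")
      case True
      with \<xi>0 \<open>0 < norm_L2 \<nu> \<xi>0\<close> show ?thesis by auto
    next
      case False
      have "sqrt (1 - e\<^sup>2) < 1" using e by simp
      moreover have "0 < opnorm_L2 \<nu> T" using False \<open>0 \<le> L\<close> by (simp add: L_def)
      ultimately obtain \<xi> where \<xi>: "\<xi> \<in> L2 \<nu>" "sqrt (1 - e\<^sup>2) * L * norm_L2 \<nu> \<xi> < norm_L2 \<nu> (T \<xi>)"
        using opnorm_L2_near_maximizer[of \<nu> T "sqrt (1 - e\<^sup>2)"] e2 unfolding L_def by auto
      have "0 < norm_L2 \<nu> \<xi>"
      proof (rule ccontr)
        \<comment> \<open>Then \<open>T \<xi>\<close> has norm 0 as well, against the strict
          inequality.\<close>
        assume "\<not> 0 < norm_L2 \<nu> \<xi>"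
        then have "norm_L2 \<nu> \<xi> = 0" using norm_L2_nonneg[of \<nu> \<xi>] by linarith
        with \<xi> opnorm_L2_bound[OF bT \<xi>(1)] show False by simp
      qed
      moreover have "(sqrt (1 - e\<^sup>2) * L * norm_L2 \<nu> \<xi>)\<^sup>2 \<le> (norm_L2 \<nu> (T \<xi>))\<^sup>2"
        using \<xi>(2) e2 \<open>0 \<le> L\<close> norm_L2_nonneg[of \<nu> \<xi>] by (intro power_mono) auto
      ultimately show ?thesis using \<xi>(1) e2 by (auto simp: power_mult_distrib)
    qed
    then obtain \<xi> where \<xi>: "\<xi> \<in> L2 \<nu>" "0 < norm_L2 \<nu> \<xi>"
      and near: "(1 - e\<^sup>2) * L\<^sup>2 * (norm_L2 \<nu> \<xi>)\<^sup>2 \<le> (norm_L2 \<nu> (T \<xi>))\<^sup>2" by blast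
    obtain Q Z where Q: "countable Q" "\<And>A. A \<in> Q \<Longrightarrow> A \<in> sets borel"
      and Z: "Z \<in> sets borel" "\<Union>Q \<inter> Z = {}" "Supp \<nu> (cutoff Z \<xi>) = {}"
      and sep: "\<And>A B a b. A \<in> Q \<Longrightarrow> B \<in> Q \<Longrightarrow> A \<noteq> B \<Longrightarrow> a \<in> A \<Longrightarrow> b \<in> B \<Longrightarrow> real (2 * k + 3) \<le> dist a b"
      and diam: "\<And>A. A \<in> Q \<Longrightarrow> ediam A \<le> of_nat (f (2 * k + 3))"
      and nonzero: "\<And>A. A \<in> Q \<Longrightarrow> \<not> (AE x in \<nu>. cutoff A \<xi> x = 0)"
      and mass: "c * (norm_L2 \<nu> \<xi>)\<^sup>2 \<le> (norm_L2 \<nu> (cutoff (\<Union>Q \<union> Z) \<xi>))\<^sup>2"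
      by (rule sparse_decomposition[OF sparse[THEN spec, of "2 * k + 3"] _ sets \<xi>(1)])
        (simp, rule that)
    have UQ: "\<Union>Q \<in> sets borel" using Q by (intro sets.countable_Union) auto
    have cut: "cutoff B \<xi> \<in> L2 \<nu>" if "B \<in> sets borel" for B
      using L2_cutoff[OF \<xi>(1)] that sets by simp
    have \<Omega>: "\<Union>Q \<union> Z \<in> sets borel" using UQ Z by auto
    have "0 < c * (norm_L2 \<nu> \<xi>)\<^sup>2" using c \<xi> by simp
    with mass have pos: "0 < (norm_L2 \<nu> (cutoff (\<Union>Q \<union> Z) \<xi>))\<^sup>2" by linarith
    have split: "cutoff (\<Union>Q \<union> Z) \<xi> = (\<lambda>x. cutoff (\<Union>Q) \<xi> x + cutoff Z \<xi> x)"
      by (rule cutoff_Un[OF Z(2)])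
    show ?thesis
    proof (cases "\<exists>A\<in>Q. c' * L * norm_L2 \<nu> (cutoff A \<xi>) \<le> norm_L2 \<nu> (T (cutoff A \<xi>))")
      case True
      then obtain A where A: "A \<in> Q" "c' * L * norm_L2 \<nu> (cutoff A \<xi>) \<le> norm_L2 \<nu> (T (cutoff A \<xi>))" by blast
      have "ediam (Supp \<nu> (cutoff A \<xi>)) \<le> of_nat (f (2 * k + 3))"
        by (rule ediam_le_of_subset_closure[OF diam[OF A(1)] Supp_cutoff_subset])
      with A nonzero[OF A(1)] cut[OF Q(2)[OF A(1)]] show ?thesis
        unfolding L_def by blast
    next
      case False
      show ?thesis
      proof (cases "L = 0")
        case True
        \<comment> \<open>For \<open>L = 0\<close> every function satisfies the norm inequality, so
          any piece in \<open>Q\<close> would have served. All mass of \<open>\<Omega>\<close> then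
          lies on \<open>Z\<close>, and the restriction to \<open>Z\<close> is a nonzero function
          whose support is empty, of diameter 0.\<close>
        have "Q = {}" using False norm_L2_nonneg by (auto simp: True)
        then have "\<not> (AE x in \<nu>. cutoff Z \<xi> x = 0)"
          using pos norm_L2_eq_0_iff[OF cut[OF Z(1)]] by auto
        moreover have "ediam (Supp \<nu> (cutoff Z \<xi>)) \<le> of_nat (f (2 * k + 3))"
          by (simp add: Z(3) ediam_def bot_ennreal)
        ultimately show ?thesis
          using cut[OF Z(1)] norm_L2_nonneg[of \<nu> "T (cutoff Z \<xi>)"] True
          by (intro exI[of _ "cutoff Z \<xi>"]) (auto simp flip: L_def)
      next
        case L: False
        \<comment> \<open>\<open>Z\<close> may carry part of the mass, but \<open>T\<close>
          annihilates it. The lower bound for \<open>\<Omega>\<close> can therefore be compared with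
          the upper bound obtained from the pieces in \<open>Q\<close>.\<close>
        have TZ: "AE x in \<nu>. T (cutoff Z \<xi>) x = 0"
          by (rule propagation_empty_Supp[OF T sets cut[OF Z(1)] Z(3)])
        then have "AE x in \<nu>. T (cutoff (\<Union>Q \<union> Z) \<xi>) x = T (cutoff (\<Union>Q) \<xi>) x"
          using bounded_operator_L2_add[OF bT cut[OF UQ] cut[OF Z(1)]]
          unfolding split by eventually_elim simp
        then have "norm_L2 \<nu> (T (cutoff (\<Union>Q \<union> Z) \<xi>)) = norm_L2 \<nu> (T (cutoff (\<Union>Q) \<xi>))"
          by (intro norm_L2_cong_AE bounded_operator_L2_in_L2[OF bT] cut UQ \<Omega>)
        also have "(norm_L2 \<nu> (T (cutoff (\<Union>Q) \<xi>)))\<^sup>2 \<le> (c' * L)\<^sup>2 * (norm_L2 \<nu> (cutoff (\<Union>Q) \<xi>))\<^sup>2"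
        proof (rule norm_L2_operator_separated_Union_le[OF T sets \<xi>(1) Q sep])
          fix A assume "A \<in> Q"
          with False have "norm_L2 \<nu> (T (cutoff A \<xi>)) \<le> c' * L * norm_L2 \<nu> (cutoff A \<xi>)" by force
          then have "(norm_L2 \<nu> (T (cutoff A \<xi>)))\<^sup>2 \<le> (c' * L * norm_L2 \<nu> (cutoff A \<xi>))\<^sup>2"
            by (intro power_mono norm_L2_nonneg)
          then show "(norm_L2 \<nu> (T (cutoff A \<xi>)))\<^sup>2 \<le> (c' * L)\<^sup>2 * (norm_L2 \<nu> (cutoff A \<xi>))\<^sup>2"
            by (simp add: power_mult_distrib)
        qed simp_all
        also have "\<dots> \<le> (c' * L)\<^sup>2 * (norm_L2 \<nu> (cutoff (\<Union>Q \<union> Z) \<xi>))\<^sup>2"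
          using UQ \<Omega> sets \<xi>(1)
          by (intro mult_left_mono power_mono norm_L2_cutoff_le norm_L2_nonneg) auto
        finally have "(norm_L2 \<nu> (T (cutoff (\<Union>Q \<union> Z) \<xi>)))\<^sup>2
            \<le> L\<^sup>2 * (norm_L2 \<nu> (cutoff (\<Union>Q \<union> Z) \<xi>))\<^sup>2 * c'\<^sup>2"
          by (simp add: power_mult_distrib mult_ac)
        moreover have "L\<^sup>2 * (norm_L2 \<nu> (cutoff (\<Union>Q \<union> Z) \<xi>))\<^sup>2 * (sqrt c - e)\<^sup>2
            \<le> (norm_L2 \<nu> (T (cutoff (\<Union>Q \<union> Z) \<xi>)))\<^sup>2"
          unfolding L_def
          using \<xi> \<Omega> sets L \<open>0 \<le> L\<close> near mass c e
          by (intro norm_L2_operator_cutoff_ge[OF bT]) (auto simp: L_def)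
        \<comment> \<open>If no piece works, the constants \<open>c'\<close> and
          \<open>sqrt c - e\<close> bound the same norm from the wrong sides; strictness needs both
          \<open>L\<close> and the mass of \<open>\<Omega>\<close> to be nonzero.\<close>
        moreover have "L\<^sup>2 * (norm_L2 \<nu> (cutoff (\<Union>Q \<union> Z) \<xi>))\<^sup>2 * c'\<^sup>2
            < L\<^sup>2 * (norm_L2 \<nu> (cutoff (\<Union>Q \<union> Z) \<xi>))\<^sup>2 * (sqrt c - e)\<^sup>2"
          using L pos c' e by (intro mult_strict_left_mono power_strict_mono mult_pos_pos) auto
        ultimately show ?thesis by linarith
      qed
    qed
  qed
  moreover have "mono (\<lambda>k. f (2 * k + 3))"
    using f by (auto simp: mono_def)
  moreover have "c' \<le> 1" using c' \<open>sqrt c \<le> 1\<close> by linarith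
  ultimately show ?thesis
    unfolding operator_norm_localization_def using c'(1)
    by (intro conjI exI[of _ "\<lambda>k. f (2 * k + 3)"]) auto
qed

theorem proposition4p1:
  fixes X :: "'a::metric_space itself"
    and H :: "'h::{complex_inner, complete_space, second_countable_topology} itself"
  assumes "infinite_dimensional H"
  shows "sqrt (sparsification_number X) \<le> opa X H"
proof -
  let ?S = "{c. operator_norm_localization X H c}"
  have bdd: "bdd_above ?S"
    by (rule bdd_aboveI[of _ 1]) (simp add: operator_norm_localization_def)
  have upper: "c' \<le> opa X H" if "operator_norm_localization X H c'" for c'
    using that cSup_upper[OF _ bdd] by (auto simp: opa_def)
  \<comment> \<open>Covers the default value 0 of \<open>opa\<close> and permits taking the root at
    the end.\<close>
  have nonneg: "0 \<le> opa X H"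
  proof (cases "\<exists>c. operator_norm_localization X H c")
    case True
    then obtain c where c: "operator_norm_localization X H c" ..
    then have "0 < c" by (simp add: operator_norm_localization_def)
    with upper[OF c] show ?thesis by simp
  qed (simp add: opa_def)
  \<comment> \<open>Comparing \<open>c\<close> with the square of \<open>opa\<close> allows the
    supremum over \<open>c\<close> to be taken before the root.\<close>
  have le: "c \<le> (opa X H)\<^sup>2" if c: "metric_sparsification X c" for c
  proof -
    have "0 < c" using c by (simp add: metric_sparsification_def)
    have "sqrt c \<le> opa X H"
    \<comment> \<open>Localization is known only for constants strictly below \<open>sqrt c\<close>;
      density of the reals closes the gap.\<close>
    proof (rule dense_le_bounded[of 0])
      fix c' assume "0 < c'" "c' < sqrt c"
      then show "c' \<le> opa X H"
        using sparsification_imp_localization[OF assms c] upper by blast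
    qed (use \<open>0 < c\<close> in simp)
    then show ?thesis by (rule sqrt_le_D)
  qed
  have "sparsification_number X \<le> (opa X H)\<^sup>2"
  proof (cases "\<exists>c. metric_sparsification X c")
    case True
    then show ?thesis
      using le by (auto simp: sparsification_number_def intro!: cSup_least)
  qed (simp add: sparsification_number_def)
  then show ?thesis
    using nonneg by (rule real_le_lsqrt[rotated])
qed

end
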